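(* Let $r\ge 2$ be an integer. There exist constants $C,D>0$ such that for any $p\in(0,1)$ the following holds. For each sufficiently large integer $n$ and all real numbers $t$ with $(\ln n)/D\le t\le n$, every $r$-uniform hypergraph $H=(V,E)$ on $n$ vertices satisfies $$\max_{S\subseteq V,\ |S|\le t}|D_p(S)|\ \ge\ C\min\{p,1-p\}\,t^{(r+1)/2}\sqrt{\ln(n/t)}.$$
   Context: For an $r$-uniform hypergraph $H=(V,E)$ (edges are $r$-element subsets of $V$), $p\in[0,1]$ and $S\subseteq V$, the $p$-discrepancy of $S$ is $D_p(S):=e(S)-p\binom{|S|}{r}$, where $e(S)$ is the number of edges of $H$ contained in $S$. Here $p$ is not assumed to be the edge density of $H$. $\ln$ is the natural logarithm. *)

theory Defs
  imports Complex_Main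
begin

definition uniform_hypergraph :: "nat \<Rightarrow> 'a set \<Rightarrow> 'a set set \<Rightarrow> bool" where
  "uniform_hypergraph r V E \<longleftrightarrow> finite V \<and> (\<forall>e\<in>E. e \<subseteq> V \<and> card e = r)"

definition edges_inside :: "'a set set \<Rightarrow> 'a set \<Rightarrow> nat" where
  "edges_inside E S = card {e \<in> E. e \<subseteq> S}"

text \<open>The parameter \<open>p\<close> is arbitrary; it need not be the edge density of the hypergraph.\<close>

definition p_discrepancy :: "nat \<Rightarrow> 'a set set \<Rightarrow> real \<Rightarrow> 'a set \<Rightarrow> real" where
  "p_discrepancy r E p S = real (edges_inside E S) - p * real (card S choose r)"

end

theory Submission
  imports Defs
begin

text \<open>Give every \<open>r\<close>-set \<open>e\<close> the weight \<open>w e = [e \<in> E] - p\<close>. Then the \<open>p\<close>-discrepancy of \<open>S\<close> is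
the total weight inside \<open>S\<close>, and all that is used about \<open>E\<close> is that every weight is at least
\<open>q = min p (1 - p)\<close> in absolute value.

By polarization it suffices to find disjoint sets \<open>B\<^sub>1, \<dots>, B\<^sub>r\<close>, of total size at most \<open>t\<close>, and a
\<open>\<plusminus>1\<close> colouring of their points for which the sum of \<open>w e\<close> over all transversals \<open>e\<close>, each taken
with the product of the colours of its points, is large: that signed sum is an alternating sum of
\<open>2\<^sup>r\<close> discrepancies of subsets of \<open>B\<^sub>1 \<union> \<dots> \<union> B\<^sub>r\<close> (\<open>signed_sum_le_discrepancy\<close>).

Let \<open>s\<close> be about \<open>t / r\<close>. Fix disjoint \<open>s\<close>-sets \<open>B\<^sub>1, \<dots>, B\<^bsub>r-1\<^esub>\<close> and colour their points at random. For a
vertex \<open>v\<close> outside them let \<open>d v\<close> be the signed sum over the \<open>r\<close>-sets consisting of \<open>v\<close> and a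
transversal. All but one of the \<open>B\<^sub>i\<close> contribute a factor \<open>sqrt s\<close> each with constant
probability, because a random signed sum is at least of the order of its standard deviation with
constant probability (\<open>signed_sum_anticoncentration\<close>). The remaining one contributes
\<open>sqrt (s * j)\<close> at the price of a factor \<open>10\<^sup>-\<^sup>j\<close> in probability: split it into \<open>j\<close> blocks and ask
each of them to deviate by its standard deviation in the same direction (\<open>sign_sum_tail\<close>). With
\<open>j\<close> a small multiple of \<open>ln (n / t)\<close> the probability that \<open>\<bar>d v\<bar>\<close> is of order
\<open>q * sqrt s ^ (r - 1) * sqrt (ln (n / t))\<close> is still at least a constant times \<open>sqrt (t / n)\<close>, so some
colouring makes \<open>\<bar>d v\<bar>\<close> that large for at least \<open>s\<close> vertices \<open>v\<close>, provided that \<open>n / t\<close> exceeds a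
constant. Let \<open>B\<^sub>r\<close> consist of \<open>s\<close> such vertices, coloured by the sign of \<open>d\<close>; the signed sum is then of order
\<open>q * t powr ((r + 1) / 2) * sqrt (ln (n / t))\<close> (\<open>weighted_discrepancy\<close>). The lower bound on \<open>t\<close>
ensures that there is room for \<open>j\<close> blocks. For \<open>t\<close> within a constant factor of \<open>n\<close>, the case of
\<open>n\<close> divided by that constant already gives the bound.\<close>

section \<open>Random signed sums\<close>

text \<open>A colouring is encoded by the set \<open>T\<close> of the points of colour \<open>1\<close>, so that a uniformly random
colouring of a finite set \<open>B\<close> is a uniformly random element of \<open>Pow B\<close>, and probabilities
become cardinalities divided by \<open>2 ^ card B\<close>.\<close>

definition sign :: "'a set \<Rightarrow> 'a \<Rightarrow> real" where
  "sign T a = (if a \<in> T then 1 else -1)"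

lemma sum_Pow_insert:
  assumes "finite F" "x \<notin> F"
  shows "(\<Sum>T\<in>Pow (insert x F). f T) = (\<Sum>T\<in>Pow F. f (insert x T) + f T :: real)"
proof -
  have inj: "inj_on (insert x) (Pow F)"
    using assms(2) by (intro inj_onI) (metis PowD insert_ident subsetD)
  have "(\<Sum>T\<in>Pow (insert x F). f T) = (\<Sum>T\<in>Pow F. f T) + (\<Sum>T\<in>insert x ` Pow F. f T)"
    unfolding Pow_insert using assms by (intro sum.union_disjoint) auto
  then show ?thesis
    by (simp add: sum.reindex[OF inj] sum.distrib)
qed

lemma sum_sign_insert:
  assumes "finite F" "x \<notin> F" "T \<subseteq> F"
  shows "(\<Sum>a\<in>insert x F. sign (insert x T) a * g a) = (\<Sum>a\<in>F. sign T a * g a) + g x"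
    and "(\<Sum>a\<in>insert x F. sign T a * g a) = (\<Sum>a\<in>F. sign T a * g a) - g x"
proof -
  have "(\<Sum>a\<in>F. sign (insert x T) a * g a) = (\<Sum>a\<in>F. sign T a * g a)"
    using assms(2) by (intro sum.cong) (auto simp: sign_def)
  moreover have "x \<notin> T" using assms by auto
  ultimately show "(\<Sum>a\<in>insert x F. sign (insert x T) a * g a) = (\<Sum>a\<in>F. sign T a * g a) + g x"
    and "(\<Sum>a\<in>insert x F. sign T a * g a) = (\<Sum>a\<in>F. sign T a * g a) - g x"
    using assms by (auto simp: sign_def)
qed

lemma second_moment_sign:
  assumes "finite B"
  shows "(\<Sum>T\<in>Pow B. (\<Sum>a\<in>B. sign T a * g a)^2) = 2 ^ card B * (\<Sum>a\<in>B. (g a)^2)"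
  using assms
proof (induction B rule: finite_induct)
  case (insert x F)
  have id2: "(u + v)^2 + (u - v)^2 = 2 * u^2 + 2 * v^2" for u v :: real
    by (simp add: power2_eq_square algebra_simps)
  have "(\<Sum>T\<in>Pow (insert x F). (\<Sum>a\<in>insert x F. sign T a * g a)^2)
      = (\<Sum>T\<in>Pow F. 2 * (\<Sum>a\<in>F. sign T a * g a)^2 + 2 * (g x)^2)"
    unfolding sum_Pow_insert[OF insert.hyps]
    by (intro sum.cong) (simp_all add: sum_sign_insert[OF insert.hyps] id2)
  then show ?case
    using insert by (simp add: sum.distrib sum_distrib_left[symmetric] card_Pow algebra_simps)
qed simp

lemma fourth_moment_sign:
  assumes "finite B"
  shows "(\<Sum>T\<in>Pow B. (\<Sum>a\<in>B. sign T a * g a)^4) \<le> 3 * 2 ^ card B * (\<Sum>a\<in>B. (g a)^2)^2"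
  using assms
proof (induction B rule: finite_induct)
  case (insert x F)
  let ?m = "\<Sum>a\<in>F. (g a)^2"
  have id4: "(u + v)^4 + (u - v)^4 = 2 * u^4 + 12 * v^2 * u^2 + 2 * v^4" for u v :: real
    by (simp add: power2_eq_square power4_eq_xxxx algebra_simps)
  have "(\<Sum>T\<in>Pow (insert x F). (\<Sum>a\<in>insert x F. sign T a * g a)^4)
      = (\<Sum>T\<in>Pow F. 2 * (\<Sum>a\<in>F. sign T a * g a)^4
          + 12 * (g x)^2 * (\<Sum>a\<in>F. sign T a * g a)^2 + 2 * (g x)^4)"
    unfolding sum_Pow_insert[OF insert.hyps]
    by (intro sum.cong) (simp_all add: sum_sign_insert[OF insert.hyps] id4)
  also have "\<dots> = 2 * (\<Sum>T\<in>Pow F. (\<Sum>a\<in>F. sign T a * g a)^4)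
      + 12 * (g x)^2 * (2 ^ card F * ?m) + 2 * 2 ^ card F * (g x)^4"
    using insert by (simp add: sum.distrib sum_distrib_left[symmetric] card_Pow second_moment_sign)
  also have "\<dots> \<le> 2 * (3 * 2 ^ card F * ?m^2)
      + 12 * (g x)^2 * (2 ^ card F * ?m) + 6 * 2 ^ card F * (g x)^4"
    using insert.IH by (intro add_mono) auto
  also have "\<dots> = 3 * 2 ^ card (insert x F) * (\<Sum>a\<in>insert x F. (g a)^2)^2"
    using insert.hyps by (simp add: power2_eq_square power4_eq_xxxx algebra_simps)
  finally show ?case .
qed simp

lemma sum_sign_complement:
  "(\<Sum>a\<in>B. sign (B - T) a * g a) = - (\<Sum>a\<in>B. sign T a * g a)"
  unfolding sum_negf[symmetric] by (intro sum.cong) (auto simp: sign_def)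

text \<open>With \<open>y = X\<^sup>2 / m\<close>, where \<open>X\<close> is the signed sum and \<open>m\<close> its second moment, the quadratic
\<open>4/7 * (y - 1/4 - y\<^sup>2/8)\<close> is at most \<open>1\<close> everywhere and at most \<open>0\<close> for \<open>y \<le> 1/4\<close>. It is thus a
lower bound for the indicator of \<open>y \<ge> 1/4\<close>, and the mean values \<open>1\<close> of \<open>y\<close> and at most \<open>3\<close> of
\<open>y\<^sup>2\<close> bound its mean from below by \<open>4/7 * 3/8 = 3/14\<close>. By symmetry each tail gets
half of this, and \<open>3/28 \<ge> 1/10\<close>.\<close>

lemma sign_sum_anticoncentration:
  assumes B: "finite B" and \<sigma>: "\<sigma> > 0" "\<sigma>^2 \<le> (\<Sum>a\<in>B. (g a)^2)"
  shows "real (card {T\<in>Pow B. \<sigma> / 2 \<le> (\<Sum>a\<in>B. sign T a * g a)}) \<ge> 1/10 * 2 ^ card B"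
proof -
  define X where "X = (\<lambda>T. \<Sum>a\<in>B. sign T a * g a)"
  define m where "m = (\<Sum>a\<in>B. (g a)^2)"
  define P where "P = {T\<in>Pow B. \<sigma> / 2 \<le> X T}"
  define Q where "Q = {T\<in>Pow B. X T \<le> - (\<sigma> / 2)}"
  have m: "m > 0" using \<sigma> zero_less_power[OF \<sigma>(1), of 2] unfolding m_def by linarith
  have fin: "finite P" "finite Q" using B unfolding P_def Q_def by auto
  \<comment> \<open>Complementing the sign pattern negates the sum, so both tails have the same size.\<close>
  have bij: "bij_betw (\<lambda>T. B - T) P Q"
    by (rule bij_betw_byWitness[where f' = "\<lambda>T. B - T"])
      (auto simp: P_def Q_def X_def sum_sign_complement Diff_Diff_Int Int_absorb1)
  have "(\<Sum>T\<in>Pow B. 4/7 * ((X T)^2 / m - 1/4 - (X T)^4 / m^2 / 8))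
      \<le> (\<Sum>T\<in>Pow B. if T \<in> P \<union> Q then 1 else 0)"
  proof (rule sum_mono)
    fix T assume T: "T \<in> Pow B"
    define y where "y = (X T)^2 / m"
    have y4: "(X T)^4 / m^2 = y^2"
      unfolding y_def by (simp add: power_divide flip: power_mult)
    have "y - 1/4 - y^2/8 = 7/4 - (y - 4)^2 / 8"
      by (simp add: power2_eq_square field_simps)
    then have 1: "4/7 * (y - 1/4 - y^2 / 8) \<le> 1" by simp
    have 2: "4/7 * (y - 1/4 - y^2 / 8) \<le> 0" if "T \<notin> P \<union> Q"
    proof -
      have "\<bar>X T\<bar> \<le> \<sigma> / 2" using that T by (auto simp: P_def Q_def)
      then have "\<bar>X T\<bar>^2 \<le> (\<sigma>/2)^2" by (intro power_mono) auto
      also have "\<dots> \<le> m / 4" using \<sigma> unfolding m_def by (simp add: power_divide)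
      finally have "y \<le> 1/4" using m unfolding y_def by (simp add: field_simps)
      then have "y - 1/4 - y^2/8 \<le> 0" using zero_le_power2[of y] by linarith
      then show ?thesis by simp
    qed
    show "4/7 * ((X T)^2 / m - 1/4 - (X T)^4 / m^2 / 8) \<le> (if T \<in> P \<union> Q then 1 else 0)"
      using 1 2 y4 unfolding y_def[symmetric] by auto
  qed
  also have "\<dots> = real (card (P \<union> Q))"
  proof -
    have "Pow B \<inter> (P \<union> Q) = P \<union> Q" by (auto simp: P_def Q_def)
    then show ?thesis using sum.inter_restrict[of "Pow B" "\<lambda>_. 1::real" "P \<union> Q"] B by simp
  qed
  also have "\<dots> \<le> real (card P) + real (card Q)"
    using card_Un_le[of P Q] by linarith
  also have "card Q = card P" using bij_betw_same_card[OF bij] by simp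
  finally have le: "(\<Sum>T\<in>Pow B. 4/7 * ((X T)^2 / m - 1/4 - (X T)^4 / m^2 / 8)) \<le> 2 * real (card P)"
    by simp
  have "(\<Sum>T\<in>Pow B. 4/7 * ((X T)^2 / m - 1/4 - (X T)^4 / m^2 / 8))
     = 4/7 * ((\<Sum>T\<in>Pow B. (X T)^2) / m - 2 ^ card B / 4 - (\<Sum>T\<in>Pow B. (X T)^4) / m^2 / 8)"
    using B by (simp add: sum_distrib_left[symmetric] sum_subtractf sum_divide_distrib[symmetric] card_Pow)
  also have "(\<Sum>T\<in>Pow B. (X T)^2) / m = 2 ^ card B"
    using second_moment_sign[OF B, of g] m unfolding X_def m_def by simp
  finally have eq: "(\<Sum>T\<in>Pow B. 4/7 * ((X T)^2 / m - 1/4 - (X T)^4 / m^2 / 8))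
    = 4/7 * (2 ^ card B - 2 ^ card B / 4 - (\<Sum>T\<in>Pow B. (X T)^4) / m^2 / 8)" .
  have "(\<Sum>T\<in>Pow B. (X T)^4) / m^2 \<le> 3 * 2 ^ card B"
    using fourth_moment_sign[OF B, of g] m unfolding X_def m_def[symmetric]
    by (simp add: pos_divide_le_eq)
  then have "2 * real (card P) \<ge> 4/7 * (2 ^ card B - 2 ^ card B / 4 - 3 * 2 ^ card B / 8)"
    using le eq by simp
  then show ?thesis unfolding P_def X_def by simp
qed

lemma card_Pow_Un:
  assumes "finite A" "finite B" "A \<inter> B = {}"
  shows "card {T\<in>Pow (A \<union> B). P T} = (\<Sum>T1\<in>Pow A. card {T2\<in>Pow B. P (T1 \<union> T2)})"
proof -
  have "bij_betw (\<lambda>(T1, T2). T1 \<union> T2) (SIGMA T1:Pow A. {T2\<in>Pow B. P (T1 \<union> T2)}) {T\<in>Pow (A \<union> B). P T}"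
  proof (rule bij_betw_byWitness[where f' = "\<lambda>T. (T \<inter> A, T \<inter> B)"])
    have *: "T \<inter> A \<union> T \<inter> B = T" if "T \<subseteq> A \<union> B" for T using that by auto
    show "(\<lambda>T. (T \<inter> A, T \<inter> B)) ` {T\<in>Pow (A \<union> B). P T} \<subseteq> (SIGMA T1:Pow A. {T2\<in>Pow B. P (T1 \<union> T2)})"
      using * by auto
    show "\<forall>T\<in>{T\<in>Pow (A \<union> B). P T}. (case (T \<inter> A, T \<inter> B) of (T1, T2) \<Rightarrow> T1 \<union> T2) = T"
      using * by auto
  qed (use assms in auto)
  then have "card (SIGMA T1:Pow A. {T2\<in>Pow B. P (T1 \<union> T2)}) = card {T\<in>Pow (A \<union> B). P T}"
    by (rule bij_betw_same_card)
  then show ?thesis using assms by simp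
qed

text \<open>This serves as the multiplication of probabilities: if a random colouring of \<open>A\<close> is good with
probability at least \<open>x\<close>, and every good colouring extends to \<open>B\<close> with conditional probability at least \<open>y\<close>,
then the joint event has probability at least \<open>x * y\<close>.\<close>

lemma card_Pow_Un_ge:
  assumes fin: "finite A" "finite B" "A \<inter> B = {}"
    and G: "G \<subseteq> Pow A" "real (card G) \<ge> x * 2 ^ card A" and y: "y \<ge> 0"
    and H: "\<And>T1. T1 \<in> G \<Longrightarrow> real (card {T2\<in>Pow B. P (T1 \<union> T2)}) \<ge> y * 2 ^ card B"
  shows "real (card {T\<in>Pow (A \<union> B). P T}) \<ge> x * y * 2 ^ card (A \<union> B)"
proof -
  have "x * y * 2 ^ card (A \<union> B) = (x * 2 ^ card A) * (y * 2 ^ card B)"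
    using fin by (simp add: card_Un_disjoint power_add)
  also have "\<dots> \<le> real (card G) * (y * 2 ^ card B)"
    using G y by (intro mult_right_mono) auto
  also have "\<dots> = (\<Sum>T1\<in>G. y * 2 ^ card B)" by simp
  also have "\<dots> \<le> (\<Sum>T1\<in>G. real (card {T2\<in>Pow B. P (T1 \<union> T2)}))"
    using H by (intro sum_mono) auto
  also have "\<dots> \<le> (\<Sum>T1\<in>Pow A. real (card {T2\<in>Pow B. P (T1 \<union> T2)}))"
    using G fin by (intro sum_mono2) auto
  also have "\<dots> = real (card {T\<in>Pow (A \<union> B). P T})"
    using card_Pow_Un[OF fin] by simp
  finally show ?thesis .
qed

lemma sum_sign_Un:
  assumes "finite A" "finite B" "A \<inter> B = {}" "T1 \<subseteq> A" "T2 \<subseteq> B"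
  shows "(\<Sum>a\<in>A \<union> B. sign (T1 \<union> T2) a * g a) = (\<Sum>a\<in>A. sign T1 a * g a) + (\<Sum>a\<in>B. sign T2 a * g a)"
proof -
  have "(\<Sum>a\<in>A. sign (T1 \<union> T2) a * g a) = (\<Sum>a\<in>A. sign T1 a * g a)"
    "(\<Sum>a\<in>B. sign (T1 \<union> T2) a * g a) = (\<Sum>a\<in>B. sign T2 a * g a)"
    using assms by (auto intro!: sum.cong simp: sign_def)
  then show ?thesis using assms by (simp add: sum.union_disjoint)
qed

text \<open>Each of \<open>Suc j\<close> disjoint blocks with \<open>l\<close> large coefficients has a sum of at least half its standard
deviation with probability at least \<open>1/10\<close>, independently of the others. All points outside the
large coefficients \<open>Q\<close> go into the last block, where they can only increase the variance.\<close>

lemma sign_sum_tail_blocks: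
  assumes "finite B" "Q \<subseteq> B" "\<And>a. a \<in> Q \<Longrightarrow> c \<le> \<bar>g a\<bar>" "c > 0" "l > 0" "Suc j * l \<le> card Q"
  shows "real (card {T\<in>Pow B. real (Suc j) * (c * sqrt l / 2) \<le> (\<Sum>a\<in>B. sign T a * g a)})
      \<ge> (1/10) ^ Suc j * 2 ^ card B"
  using assms
proof (induction j arbitrary: B Q)
  case 0
  have sq: "c^2 \<le> (g a)^2" if "a \<in> Q" for a
    using power_mono[OF 0(3)[OF that], of 2] 0(4) by simp
  have "(c * sqrt l)^2 = (real l) * c^2" by (simp add: power_mult_distrib)
  also have "\<dots> \<le> real (card Q) * c^2" using 0 by (intro mult_right_mono) auto
  also have "\<dots> = (\<Sum>a\<in>Q. c^2)" by simp
  also have "\<dots> \<le> (\<Sum>a\<in>Q. (g a)^2)" using sq by (rule sum_mono)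
  also have "\<dots> \<le> (\<Sum>a\<in>B. (g a)^2)" using 0 by (intro sum_mono2) auto
  finally have "(c * sqrt l)^2 \<le> (\<Sum>a\<in>B. (g a)^2)" .
  from sign_sum_anticoncentration[OF 0(1) _ this] 0 show ?case by simp
next
  case (Suc j)
  have finQ: "finite Q" using Suc.prems finite_subset by blast
  have "l \<le> card Q" using Suc.prems(6) by simp
  then obtain A where A: "A \<subseteq> Q" "card A = l" "finite A"
    by (rule obtain_subset_with_card_n)
  have AB: "A \<subseteq> B" "A \<inter> (B - A) = {}" "A \<union> (B - A) = B" using A Suc.prems by auto
  have cQ: "card (Q - A) = card Q - l" using A finQ by (simp add: card_Diff_subset)
  define G where "G = {T\<in>Pow A. c * sqrt l / 2 \<le> (\<Sum>a\<in>A. sign T a * g a)}"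
  have sq: "c^2 \<le> (g a)^2" if "a \<in> A" for a
    using power_mono[OF Suc.prems(3), of a 2] Suc.prems(4) that A by auto
  have "(c * sqrt l)^2 = (\<Sum>a\<in>A. c^2)" using A by (simp add: power_mult_distrib)
  also have "\<dots> \<le> (\<Sum>a\<in>A. (g a)^2)" using sq by (rule sum_mono)
  finally have "(c * sqrt l)^2 \<le> (\<Sum>a\<in>A. (g a)^2)" .
  from sign_sum_anticoncentration[OF A(3) _ this] Suc.prems
  have G: "real (card G) \<ge> 1/10 * 2 ^ card A" unfolding G_def by simp
  have IH: "real (card {T\<in>Pow (B - A). real (Suc j) * (c * sqrt l / 2) \<le> (\<Sum>a\<in>B - A. sign T a * g a)})
      \<ge> (1/10) ^ Suc j * 2 ^ card (B - A)"
    using Suc.prems cQ by (intro Suc.IH[of "B - A" "Q - A"]) auto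
  have "real (card {T\<in>Pow (A \<union> (B - A)). real (Suc (Suc j)) * (c * sqrt l / 2) \<le> (\<Sum>a\<in>B. sign T a * g a)})
      \<ge> 1/10 * (1/10) ^ Suc j * 2 ^ card (A \<union> (B - A))"
  proof (rule card_Pow_Un_ge[OF A(3) _ AB(2) _ G])
    fix T1 assume T1: "T1 \<in> G"
    have "{T\<in>Pow (B - A). real (Suc j) * (c * sqrt l / 2) \<le> (\<Sum>a\<in>B - A. sign T a * g a)}
      \<subseteq> {T2\<in>Pow (B - A). real (Suc (Suc j)) * (c * sqrt l / 2) \<le> (\<Sum>a\<in>B. sign (T1 \<union> T2) a * g a)}"
    proof safe
      fix T2 x assume T2: "T2 \<subseteq> B - A"
        "real (Suc j) * (c * sqrt l / 2) \<le> (\<Sum>a\<in>B - A. sign T2 a * g a)"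
      have "(\<Sum>a\<in>B. sign (T1 \<union> T2) a * g a)
         = (\<Sum>a\<in>A. sign T1 a * g a) + (\<Sum>a\<in>B - A. sign T2 a * g a)"
        using sum_sign_Un[of A "B - A" T1 T2 g] T1 T2 A Suc.prems(1) AB unfolding G_def by auto
      then show "real (Suc (Suc j)) * (c * sqrt l / 2) \<le> (\<Sum>a\<in>B. sign (T1 \<union> T2) a * g a)"
        using T1 T2(2) unfolding G_def by (auto simp: algebra_simps)
    qed
    then have "card {T\<in>Pow (B - A). real (Suc j) * (c * sqrt l / 2) \<le> (\<Sum>a\<in>B - A. sign T a * g a)}
      \<le> card {T2\<in>Pow (B - A). real (Suc (Suc j)) * (c * sqrt l / 2) \<le> (\<Sum>a\<in>B. sign (T1 \<union> T2) a * g a)}"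
      using Suc.prems(1) by (intro card_mono) auto
    then show "real (card {T2\<in>Pow (B - A). real (Suc (Suc j)) * (c * sqrt l / 2) \<le> (\<Sum>a\<in>B. sign (T1 \<union> T2) a * g a)})
       \<ge> (1/10) ^ Suc j * 2 ^ card (B - A)"
      using IH by linarith
  qed (use Suc.prems G_def in auto)
  then show ?case unfolding AB(3) by simp
qed

text \<open>Taking \<open>j\<close> blocks of \<open>card Q div j\<close> large coefficients trades a factor \<open>10\<^sup>-\<^sup>j\<close> in probability for a factor
\<open>sqrt j\<close> in the deviation, which is the Gaussian order of magnitude. The rounding in
\<open>card Q div j\<close> costs at most a factor \<open>2\<close> in the length of the blocks.\<close>

lemma sign_sum_tail:
  assumes B: "finite B" "Q \<subseteq> B" and g: "\<And>a. a \<in> Q \<Longrightarrow> c \<le> \<bar>g a\<bar>" "c > 0"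
    and j: "1 \<le> j" "j \<le> card Q"
  shows "real (card {T\<in>Pow B. c * sqrt (real (card Q) * real j) / 4 \<le> \<bar>\<Sum>a\<in>B. sign T a * g a\<bar>})
      \<ge> (1/10) ^ j * 2 ^ card B"
proof -
  \<comment> \<open>The largest block length for which \<open>j\<close> blocks fit into \<open>Q\<close>.\<close>
  define l where "l = card Q div j"
  have l: "l > 0" "j * l \<le> card Q" using j by (auto simp: l_def div_greater_zero_iff)
  have "card Q < j * l + j" using j unfolding l_def
    by (metis add.commute dividend_less_times_div less_le_trans zero_less_one)
  also have "\<dots> \<le> 2 * (j * l)" using l(1) by (simp add: mult_2)
  finally have "real (card Q) \<le> 2 * (real j * real l)" by (metis less_imp_le of_nat_le_iff of_nat_mult of_nat_numeral)
  then have "real (card Q) * real j \<le> 2 * (real j * real l) * real j"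
    by (intro mult_right_mono) auto
  also have "\<dots> \<le> 4 * (real j * real j * real l)" by simp
  finally have "real (card Q) * real j \<le> 4 * (real j * real j * real l)" .
  then have "sqrt (real (card Q) * real j) \<le> sqrt (4 * (real j * real j * real l))"
    by (rule real_sqrt_le_mono)
  also have "\<dots> = 2 * (real j * sqrt l)"
    by (simp add: real_sqrt_mult)
  finally have "c * sqrt (real (card Q) * real j) \<le> c * (2 * (real j * sqrt l))"
    using g(2) by (intro mult_left_mono) auto
  then have le: "c * sqrt (real (card Q) * real j) / 4 \<le> real j * (c * sqrt l / 2)"
    by (simp add: algebra_simps)
  have "real (card {T\<in>Pow B. real j * (c * sqrt l / 2) \<le> (\<Sum>a\<in>B. sign T a * g a)})
      \<ge> (1/10) ^ j * 2 ^ card B"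
    using sign_sum_tail_blocks[where j = "j - 1", OF B g l(1)] l j by simp
  also have "card {T\<in>Pow B. real j * (c * sqrt l / 2) \<le> (\<Sum>a\<in>B. sign T a * g a)}
     \<le> card {T\<in>Pow B. c * sqrt (real (card Q) * real j) / 4 \<le> \<bar>\<Sum>a\<in>B. sign T a * g a\<bar>}"
    using le B by (intro card_mono) auto
  finally show ?thesis by simp
qed

section \<open>Signed sums over transversals\<close>

text \<open>Sum of \<open>w\<close> over the sets \<open>e \<union> {b\<^sub>1, \<dots>, b\<^sub>k}\<close> with \<open>b\<^sub>i\<close> in the \<open>i\<close>-th set of the list, each
weighted by the product of the colours of the \<open>b\<^sub>i\<close>. The recursion matches the order in which
the randomness is exposed: the colours of the tail of the list come first.\<close>

fun signed_sum :: "('a set \<Rightarrow> real) \<Rightarrow> 'a set \<Rightarrow> 'a set list \<Rightarrow> 'a set \<Rightarrow> real" where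
  "signed_sum w T [] e = w e"
| "signed_sum w T (B # Bs) e = (\<Sum>a\<in>B. sign T a * signed_sum w T Bs (insert a e))"

abbreviation disjoint_list :: "'a set list \<Rightarrow> bool" where
  "disjoint_list \<equiv> sorted_wrt (\<lambda>A B. A \<inter> B = {})"

lemma signed_sum_cong:
  "T \<inter> \<Union>(set Bs) = T' \<inter> \<Union>(set Bs) \<Longrightarrow> signed_sum w T Bs e = signed_sum w T' Bs e"
proof (induction Bs arbitrary: e)
  case (Cons B Bs)
  have "sign T a = sign T' a" if "a \<in> B" for a
    using Cons.prems that by (auto simp: sign_def)
  moreover have "signed_sum w T Bs e = signed_sum w T' Bs e" for e
    using Cons.prems by (intro Cons.IH) auto
  ultimately show ?case by simp
qed simp

lemma sum_card_swap:
  assumes "finite I" "finite J"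
  shows "(\<Sum>a\<in>I. card {x\<in>J. R a x}) = (\<Sum>x\<in>J. card {a\<in>I. R a x})"
  using assms by (intro sum_multicount_gen) auto

lemma sum_card_swap_ge:
  assumes "finite I" "finite J" "\<And>a. a \<in> I \<Longrightarrow> \<beta> * real (card J) \<le> real (card {x\<in>J. R a x})"
  shows "\<beta> * real (card J) * real (card I) \<le> (\<Sum>x\<in>J. real (card {a\<in>I. R a x}))"
proof -
  have "\<beta> * real (card J) * real (card I) = (\<Sum>a\<in>I. \<beta> * real (card J))" by simp
  also have "\<dots> \<le> (\<Sum>a\<in>I. real (card {x\<in>J. R a x}))" using assms by (intro sum_mono)
  also have "\<dots> = (\<Sum>x\<in>J. real (card {a\<in>I. R a x}))"
    using sum_card_swap[OF assms(1,2), of R] by (simp flip: of_nat_sum)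
  finally show ?thesis .
qed

text \<open>The first moment method: some \<open>x\<close> does at least as well as a random one does on average.\<close>

lemma exists_typical_point:
  assumes "finite I" "finite J" "J \<noteq> {}"
    "\<And>a. a \<in> I \<Longrightarrow> \<beta> * real (card J) \<le> real (card {x\<in>J. R a x})"
  shows "\<exists>x\<in>J. \<beta> * real (card I) \<le> real (card {a\<in>I. R a x})"
proof (rule ccontr)
  assume "\<not> ?thesis"
  then have "(\<Sum>x\<in>J. real (card {a\<in>I. R a x})) < (\<Sum>x\<in>J. \<beta> * real (card I))"
    using assms by (intro sum_strict_mono) auto
  moreover have "\<beta> * real (card J) * real (card I) \<le> (\<Sum>x\<in>J. real (card {a\<in>I. R a x}))"
    using sum_card_swap_ge[of I J \<beta> R] assms by blast
  ultimately show False by (simp add: mult_ac)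
qed

text \<open>The average over \<open>x\<close> of the related fraction of \<open>I\<close> is at least \<open>\<beta>\<close>. The \<open>x\<close> related to less than the
fraction \<open>\<beta> / 2\<close> contribute at most \<open>\<beta> / 2\<close> to it, so the others contribute at least \<open>\<beta> / 2\<close>.\<close>

lemma many_typical_points:
  assumes I: "finite I" "I \<noteq> {}" and J: "finite J"
    and \<beta>: "\<And>a. a \<in> I \<Longrightarrow> \<beta> * real (card J) \<le> real (card {x\<in>J. R a x})" "\<beta> \<ge> 0"
  shows "\<beta> / 2 * real (card J) \<le> real (card {x\<in>J. \<beta> / 2 * real (card I) \<le> real (card {a\<in>I. R a x})})"
proof -
  define G where "G = {x\<in>J. \<beta> / 2 * real (card I) \<le> real (card {a\<in>I. R a x})}"
  have G: "G \<subseteq> J" "J \<inter> G = G" by (auto simp: G_def)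
  have "\<beta> * real (card J) * real (card I) \<le> (\<Sum>x\<in>J. real (card {a\<in>I. R a x}))"
    using sum_card_swap_ge[of I J \<beta> R] I J \<beta> by blast
  also have "\<dots> \<le> (\<Sum>x\<in>J. (if x \<in> G then real (card I) else 0) + \<beta> / 2 * real (card I))"
  proof (rule sum_mono)
    fix x assume x: "x \<in> J"
    have "card {a\<in>I. R a x} \<le> card I" using I by (intro card_mono) auto
    then show "real (card {a\<in>I. R a x}) \<le> (if x \<in> G then real (card I) else 0) + \<beta> / 2 * real (card I)"
      using x \<beta>(2) by (auto simp: G_def intro: add_increasing2)
  qed
  also have "\<dots> = real (card G) * real (card I) + \<beta> / 2 * real (card J) * real (card I)"
    using J G sum.inter_restrict[of J "\<lambda>_. real (card I)" G] by (simp add: sum.distrib)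
  finally have "(\<beta> / 2 * real (card J)) * real (card I) \<le> real (card G) * real (card I)"
    by (simp add: algebra_simps)
  then show ?thesis using I unfolding G_def[symmetric] by (simp add: card_gt_0_iff)
qed

text \<open>Expose the colours of \<open>Bs\<close> first. With probability at least \<open>\<beta> / 2\<close> at least \<open>\<beta> / 2 * card B\<close> of the
coefficients \<open>signed_sum w T Bs (insert a e)\<close>, \<open>a \<in> B\<close>, are large; the colours of \<open>B\<close> are
independent of them, so the tail bound for signed sums applies. The alternative \<open>j = 1\<close> is needed for
sets \<open>B\<close> so small that \<open>\<beta> / 2 * card B < 1\<close>.\<close>

lemma signed_sum_Cons_anticoncentration:
  fixes w :: "'a set \<Rightarrow> real"
  defines "Y Bs \<equiv> \<Union>(set Bs)"
  assumes fin: "finite B" "B \<noteq> {}" "finite (Y Bs)" "B \<inter> Y Bs = {}" and c: "c > 0" "\<beta> > 0"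
    and H: "\<And>a. a \<in> B \<Longrightarrow> \<beta> * 2 ^ card (Y Bs)
              \<le> real (card {T\<in>Pow (Y Bs). c \<le> \<bar>signed_sum w T Bs (insert a e)\<bar>})"
    and j: "1 \<le> j" "j = 1 \<or> real j \<le> \<beta> / 2 * real (card B)"
  shows "\<beta> / 2 * (1/10) ^ j * 2 ^ card (Y (B # Bs))
    \<le> real (card {T\<in>Pow (Y (B # Bs)). c * sqrt (\<beta> / 2 * real (card B) * real j) / 4 \<le> \<bar>signed_sum w T (B # Bs) e\<bar>})"
proof -
  define good where "good T = {a\<in>B. c \<le> \<bar>signed_sum w T Bs (insert a e)\<bar>}" for T
  define G where "G = {T\<in>Pow (Y Bs). \<beta> / 2 * real (card B) \<le> real (card (good T))}"
  have G: "\<beta> / 2 * 2 ^ card (Y Bs) \<le> real (card G)"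
    using many_typical_points[of B "Pow (Y Bs)" \<beta> "\<lambda>a T. c \<le> \<bar>signed_sum w T Bs (insert a e)\<bar>"]
      fin H c unfolding G_def good_def by (simp add: card_Pow)
  have disj: "Y Bs \<inter> B = {}" using fin by auto
  have YB: "Y (B # Bs) = Y Bs \<union> B" by (auto simp: Y_def)
  show ?thesis unfolding YB
  proof (rule card_Pow_Un_ge[OF fin(3) fin(1) disj _ G])
    fix T1 assume T1: "T1 \<in> G"
    define g where "g a = signed_sum w T1 Bs (insert a e)" for a
    have eq: "signed_sum w (T1 \<union> T2) (B # Bs) e = (\<Sum>a\<in>B. sign T2 a * g a)" if "T2 \<subseteq> B" for T2
    proof -
      have "signed_sum w (T1 \<union> T2) Bs f = signed_sum w T1 Bs f" for f
        using that disj by (intro signed_sum_cong) (auto simp: Y_def)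
      moreover have "sign (T1 \<union> T2) a = sign T2 a" if "a \<in> B" for a
        using that T1 disj by (auto simp: sign_def G_def)
      ultimately show ?thesis by (simp add: g_def)
    qed
    have m: "\<beta> / 2 * real (card B) \<le> real (card (good T1))" using T1 by (simp add: G_def)
    have "\<beta> / 2 * real (card B) > 0" using c fin by (simp add: card_gt_0_iff)
    then have "card (good T1) > 0" using m by linarith
    then have jm: "j \<le> card (good T1)" using j m by auto
    have "real (card {T\<in>Pow B. c * sqrt (real (card (good T1)) * real j) / 4 \<le> \<bar>\<Sum>a\<in>B. sign T a * g a\<bar>})
      \<ge> (1/10) ^ j * 2 ^ card B"
      by (rule sign_sum_tail) (use fin c j jm in \<open>auto simp: good_def g_def\<close>)
    also have "card {T\<in>Pow B. c * sqrt (real (card (good T1)) * real j) / 4 \<le> \<bar>\<Sum>a\<in>B. sign T a * g a\<bar>}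
      \<le> card {T2\<in>Pow B. c * sqrt (\<beta> / 2 * real (card B) * real j) / 4 \<le> \<bar>signed_sum w (T1 \<union> T2) (B # Bs) e\<bar>}"
    proof (rule card_mono)
      have "c * sqrt (\<beta> / 2 * real (card B) * real j) / 4 \<le> c * sqrt (real (card (good T1)) * real j) / 4"
        using m c by (intro divide_right_mono mult_left_mono real_sqrt_le_mono mult_right_mono) auto
      then show "{T\<in>Pow B. c * sqrt (real (card (good T1)) * real j) / 4 \<le> \<bar>\<Sum>a\<in>B. sign T a * g a\<bar>}
        \<subseteq> {T2\<in>Pow B. c * sqrt (\<beta> / 2 * real (card B) * real j) / 4 \<le> \<bar>signed_sum w (T1 \<union> T2) (B # Bs) e\<bar>}"
        using eq by (auto simp del: signed_sum.simps)
    qed (use fin in auto)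
    finally show "real (card {T2\<in>Pow B. c * sqrt (\<beta> / 2 * real (card B) * real j) / 4 \<le> \<bar>signed_sum w (T1 \<union> T2) (B # Bs) e\<bar>})
      \<ge> (1/10) ^ j * 2 ^ card B" by simp
  qed (auto simp: G_def)
qed

text \<open>Every further set in the list costs a factor \<open>1/2\<close> for the choice of good coefficients and \<open>1/10\<close> for
the deviation in probability, and, apart from \<open>sqrt s\<close>, a factor \<open>sqrt (tail_prob k / 2) / 4\<close> in
size.\<close>

definition tail_prob :: "nat \<Rightarrow> real" where
  "tail_prob k = (1/20) ^ k"

fun tail_scale :: "nat \<Rightarrow> real" where
  "tail_scale 0 = 1"
| "tail_scale (Suc k) = tail_scale k * sqrt (tail_prob k / 2) / 4"

lemma tail_prob_bounds: "0 < tail_prob k" "tail_prob k \<le> 1"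
  by (auto simp: tail_prob_def power_le_one)

lemma tail_scale_pos: "0 < tail_scale k"
  by (induction k) (auto simp: tail_prob_bounds)

lemma signed_sum_anticoncentration:
  fixes Bs :: "'a set list"
  assumes "disjoint_list Bs" "\<forall>B\<in>set Bs. finite B \<and> card B = s" "s > 0"
    and "finite e" "e \<inter> \<Union>(set Bs) = {}"
    and "q > 0" "\<And>f. finite f \<Longrightarrow> card f = card e + length Bs \<Longrightarrow> q \<le> \<bar>w f\<bar>"
  shows "tail_prob (length Bs) * 2 ^ card (\<Union>(set Bs))
    \<le> real (card {T\<in>Pow (\<Union>(set Bs)).
        q * tail_scale (length Bs) * sqrt (real s) ^ length Bs \<le> \<bar>signed_sum w T Bs e\<bar>})"
  using assms
proof (induction Bs arbitrary: e)
  case Nil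
  have "{T :: 'a set. T = {} \<and> q \<le> \<bar>w e\<bar>} = {{}}" using Nil by auto
  then show ?case by (simp add: tail_prob_def)
next
  case (Cons B Bs)
  let ?k = "length Bs" and ?Y = "\<Union>(set Bs)"
  have B: "finite B" "card B = s" "B \<noteq> {}" "finite ?Y" "B \<inter> ?Y = {}" using Cons.prems by auto
  have c: "0 < q * tail_scale ?k * sqrt (real s) ^ ?k" using Cons.prems tail_scale_pos by simp
  have "tail_prob ?k / 2 * (1/10) ^ 1 * 2 ^ card (\<Union>(set (B # Bs)))
    \<le> real (card {T\<in>Pow (\<Union>(set (B # Bs))).
        q * tail_scale ?k * sqrt (real s) ^ ?k * sqrt (tail_prob ?k / 2 * real (card B) * real 1) / 4
          \<le> \<bar>signed_sum w T (B # Bs) e\<bar>})"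
  proof (rule signed_sum_Cons_anticoncentration[OF B(1,3-5) c tail_prob_bounds(1)])
    fix a assume a: "a \<in> B"
    have "a \<notin> e" using a Cons.prems by auto
    show "tail_prob ?k * 2 ^ card ?Y
       \<le> real (card {T\<in>Pow ?Y. q * tail_scale ?k * sqrt (real s) ^ ?k \<le> \<bar>signed_sum w T Bs (insert a e)\<bar>})"
      by (rule Cons.IH) (use Cons.prems a \<open>a \<notin> e\<close> B in auto)
  qed auto
  moreover have "q * tail_scale ?k * sqrt (real s) ^ ?k * sqrt (tail_prob ?k / 2 * real (card B) * real 1) / 4
     = q * tail_scale (length (B # Bs)) * sqrt (real s) ^ length (B # Bs)"
    unfolding B(2) by (simp only: real_sqrt_mult) simp
  moreover have "tail_prob ?k / 2 * (1/10) ^ 1 = tail_prob (length (B # Bs))"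
    by (simp add: tail_prob_def)
  ultimately show ?case by (simp only:)
qed

section \<open>Polarization\<close>

text \<open>Iterated differences of a set function, one for each set of the list: its part of colour \<open>1\<close> is
added in the first term and its part of colour \<open>-1\<close> in the second.\<close>

fun alternating :: "('a set \<Rightarrow> real) \<Rightarrow> 'a set \<Rightarrow> 'a set list \<Rightarrow> 'a set \<Rightarrow> real" where
  "alternating f T [] S = f S"
| "alternating f T (B # Bs) S = alternating f T Bs (S \<union> (B \<inter> T)) - alternating f T Bs (S \<union> (B - T))"

lemma alternating_le:
  assumes "\<And>S. S \<subseteq> X \<Longrightarrow> \<bar>f S\<bar> \<le> M" "S \<union> \<Union>(set Bs) \<subseteq> X"
  shows "\<bar>alternating f T Bs S\<bar> \<le> 2 ^ length Bs * M"
  using assms(2)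
proof (induction Bs arbitrary: S)
  case (Cons B Bs)
  have "\<bar>alternating f T Bs (S \<union> (B \<inter> T))\<bar> \<le> 2 ^ length Bs * M"
    "\<bar>alternating f T Bs (S \<union> (B - T))\<bar> \<le> 2 ^ length Bs * M"
    using Cons.prems by (intro Cons.IH; auto)+
  then show ?case by simp
qed (use assms in auto)

text \<open>The factor with which a set \<open>e\<close> survives the difference for \<open>B\<close>. It vanishes if \<open>e\<close> misses \<open>B\<close>, and it is
the colour of the common point if \<open>e\<close> meets \<open>B\<close> in exactly one point.\<close>

definition side :: "'a set \<Rightarrow> 'a set \<Rightarrow> 'a set \<Rightarrow> real" where
  "side T B e = of_bool (e \<inter> B \<subseteq> T) - of_bool (e \<inter> B \<inter> T = {})"

text \<open>Expanding the differences: \<open>e\<close> is counted in the first term of the difference for \<open>B\<close> if \<open>e \<inter> B\<close> has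
only colour \<open>1\<close>, and in the second if it has only colour \<open>-1\<close>.\<close>

lemma alternating_subset_sum:
  assumes "finite S" "\<forall>B\<in>set Bs. finite B" "disjoint_list Bs" "S \<inter> \<Union>(set Bs) = {}"
  shows "alternating (\<lambda>S. \<Sum>e | e \<subseteq> S \<and> card e = m. w e) T Bs S
    = (\<Sum>e | e \<subseteq> S \<union> \<Union>(set Bs) \<and> card e = m. w e * (\<Prod>B\<leftarrow>Bs. side T B e))"
  using assms
proof (induction Bs arbitrary: S)
  case (Cons B Bs)
  let ?Y = "\<Union>(set Bs)" and ?g = "\<lambda>e. w e * (\<Prod>B\<leftarrow>Bs. side T B e)"
  let ?X = "{e. e \<subseteq> S \<union> (B \<union> ?Y) \<and> card e = m}"
  have fin: "finite ?X" using Cons.prems by auto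
  have part: "alternating (\<lambda>S. \<Sum>e | e \<subseteq> S \<and> card e = m. w e) T Bs (S \<union> B')
      = (\<Sum>e\<in>?X. if e \<inter> B \<subseteq> B' then ?g e else 0)" if "B' \<subseteq> B" for B'
  proof -
    have "B' \<inter> ?Y = {}" using that Cons.prems(3) by fastforce
    then have disj: "(S \<union> B') \<inter> ?Y = {}" using Cons.prems(4) by auto
    have "alternating (\<lambda>S. \<Sum>e | e \<subseteq> S \<and> card e = m. w e) T Bs (S \<union> B')
       = (\<Sum>e | e \<subseteq> (S \<union> B') \<union> ?Y \<and> card e = m. ?g e)"
      using Cons.prems that finite_subset[OF that] disj by (intro Cons.IH) simp_all
    also have "{e. e \<subseteq> (S \<union> B') \<union> ?Y \<and> card e = m} = ?X \<inter> {e. e \<inter> B \<subseteq> B'}"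
      using disj Cons.prems(3,4) that by fastforce
    also have "sum ?g \<dots> = (\<Sum>e\<in>?X. if e \<inter> B \<subseteq> B' then ?g e else 0)"
      using sum.inter_restrict[OF fin, of ?g "{e. e \<inter> B \<subseteq> B'}"] by simp
    finally show ?thesis .
  qed
  have "alternating (\<lambda>S. \<Sum>e | e \<subseteq> S \<and> card e = m. w e) T (B # Bs) S
     = (\<Sum>e\<in>?X. (if e \<inter> B \<subseteq> B \<inter> T then ?g e else 0) - (if e \<inter> B \<subseteq> B - T then ?g e else 0))"
    by (simp add: part sum_subtractf)
  also have "\<dots> = (\<Sum>e\<in>?X. w e * (\<Prod>B\<leftarrow>B # Bs. side T B e))"
  proof (rule sum.cong)
    fix e
    have "e \<inter> B \<subseteq> B \<inter> T \<longleftrightarrow> e \<inter> B \<subseteq> T" "e \<inter> B \<subseteq> B - T \<longleftrightarrow> e \<inter> B \<inter> T = {}" by auto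
    then show "(if e \<inter> B \<subseteq> B \<inter> T then ?g e else 0) - (if e \<inter> B \<subseteq> B - T then ?g e else 0)
      = w e * (\<Prod>B\<leftarrow>B # Bs. side T B e)"
      by (simp add: side_def)
  qed simp
  finally show ?case by simp
qed simp

lemma card_transversal_ge:
  assumes "finite e" "disjoint_list Bs" "\<forall>B\<in>set Bs. e \<inter> B \<noteq> {}"
  shows "length Bs \<le> card (e \<inter> \<Union>(set Bs))"
  using assms
proof (induction Bs)
  case (Cons B Bs)
  have "card (e \<inter> B) \<ge> 1" using Cons.prems by (simp add: Suc_le_eq card_gt_0_iff)
  moreover have "card (e \<inter> \<Union>(set (B # Bs))) = card (e \<inter> B) + card (e \<inter> \<Union>(set Bs))"
    using Cons.prems by (subst card_Un_disjoint[symmetric]) (auto simp: Int_Un_distrib)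
  ultimately show ?case using Cons by simp
qed simp

text \<open>If \<open>e\<close> has as many points as there are sets in the list and meets all of these disjoint sets, it meets each of
them in exactly one point; all other \<open>e\<close> have a vanishing factor. Removing the point in
the first set gives the recursion of \<open>signed_sum\<close>.\<close>

lemma sum_sides_eq_signed_sum:
  assumes "\<forall>B\<in>set Bs. finite B" "disjoint_list Bs"
  shows "(\<Sum>e | e \<subseteq> \<Union>(set Bs) \<and> card e = length Bs. w (e \<union> e0) * (\<Prod>B\<leftarrow>Bs. side T B e))
    = signed_sum w T Bs e0"
  using assms
proof (induction Bs arbitrary: e0)
  case Nil
  have "{e :: 'a set. e = {} \<and> card e = 0} = {{}}" by auto
  then show ?case by simp
next
  case (Cons B Bs)
  let ?Y = "\<Union>(set Bs)" and ?k = "length Bs"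
  let ?g = "\<lambda>e. w (e \<union> e0) * (\<Prod>B\<leftarrow>B # Bs. side T B e)"
  let ?X = "{e. e \<subseteq> B \<union> ?Y \<and> card e = Suc ?k}"
  let ?Z = "B \<times> {e. e \<subseteq> ?Y \<and> card e = ?k}"
  have fin: "finite B" "finite ?Y" and disj: "B \<inter> ?Y = {}" using Cons.prems by auto
  have inj: "inj_on (\<lambda>(a, e). insert a e) ?Z"
  proof (rule inj_onI, clarify)
    fix a e a' e'
    assume *: "a \<in> B" "e \<subseteq> ?Y" "a' \<in> B" "e' \<subseteq> ?Y" "insert a e = insert a' e'"
    have "insert a e \<inter> B = {a}" "insert a e \<inter> ?Y = e" using *(1,2) disj by auto
    moreover have "insert a' e' \<inter> B = {a'}" "insert a' e' \<inter> ?Y = e'" using *(3,4) disj by auto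
    ultimately show "a = a' \<and> e = e'" using *(5) by (metis singleton_inject)
  qed
  have sub: "(\<lambda>(a, e). insert a e) ` ?Z \<subseteq> ?X"
  proof clarify
    fix a e assume *: "a \<in> B" "e \<subseteq> ?Y" "card e = ?k"
    then have "a \<notin> e" "finite e" using disj fin finite_subset by auto
    then show "insert a e \<subseteq> B \<union> ?Y \<and> card (insert a e) = Suc ?k" using * by auto
  qed
  have zero: "?g e = 0" if e: "e \<in> ?X - (\<lambda>(a, e). insert a e) ` ?Z" for e
  proof (rule ccontr)
    assume nz: "?g e \<noteq> 0"
    have fe: "finite e" using e fin finite_subset[of e "B \<union> ?Y"] by auto
    have s: "\<forall>A\<in>set (B # Bs). e \<inter> A \<noteq> {}"
    proof
      fix A assume A: "A \<in> set (B # Bs)"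
      have "side T A e \<noteq> 0"
        using nz A by (auto simp: prod_list_zero_iff)
      then show "e \<inter> A \<noteq> {}" by (auto simp: side_def)
    qed
    have "(e \<inter> B) \<union> (e \<inter> ?Y) = e" using e by auto
    moreover have "card ((e \<inter> B) \<union> (e \<inter> ?Y)) = card (e \<inter> B) + card (e \<inter> ?Y)"
      using disj fe by (intro card_Un_disjoint) auto
    ultimately have "card e = card (e \<inter> B) + card (e \<inter> ?Y)" by simp
    moreover have "?k \<le> card (e \<inter> ?Y)" using card_transversal_ge[of e Bs] s fe Cons.prems by auto
    moreover have "card (e \<inter> B) \<noteq> 0" using s fe by auto
    ultimately have "card (e \<inter> B) = 1" and cY: "card (e \<inter> ?Y) = ?k" using e by auto
    then obtain a where a: "e \<inter> B = {a}" by (auto simp: card_1_singleton_iff)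
    then have "e = insert a (e \<inter> ?Y)" "a \<in> B" using e by auto
    then show False using e cY by (auto simp: image_iff)
  qed
  have "(\<Sum>e\<in>?X. ?g e) = (\<Sum>e\<in>(\<lambda>(a, e). insert a e) ` ?Z. ?g e)"
    using sub zero fin by (intro sum.mono_neutral_right) auto
  also have "\<dots> = (\<Sum>(a, e)\<in>?Z. ?g (insert a e))"
    by (subst sum.reindex[OF inj]) (simp add: case_prod_unfold)
  also have "\<dots> = (\<Sum>(a, e)\<in>?Z. sign T a * (w (e \<union> insert a e0) * (\<Prod>B\<leftarrow>Bs. side T B e)))"
  proof (rule sum.cong, simp, clarify)
    fix a e assume *: "a \<in> B" "e \<subseteq> ?Y"
    have "insert a e \<inter> B = {a}" using * disj by auto
    then have 1: "side T B (insert a e) = sign T a" by (auto simp: side_def sign_def)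
    have 2: "(\<Prod>A\<leftarrow>Bs. side T A (insert a e)) = (\<Prod>A\<leftarrow>Bs. side T A e)"
    proof (intro arg_cong[where f = prod_list] map_cong refl)
      fix A assume "A \<in> set Bs"
      then have "a \<notin> A" using * disj by auto
      then show "side T A (insert a e) = side T A e" by (simp add: side_def)
    qed
    show "?g (insert a e) = sign T a * (w (e \<union> insert a e0) * (\<Prod>B\<leftarrow>Bs. side T B e))"
      using 1 2 by simp
  qed
  also have "\<dots> = (\<Sum>a\<in>B. sign T a * (\<Sum>e | e \<subseteq> ?Y \<and> card e = ?k. w (e \<union> insert a e0) * (\<Prod>B\<leftarrow>Bs. side T B e)))"
    by (simp add: sum.cartesian_product[symmetric] sum_distrib_left)
  also have "\<dots> = (\<Sum>a\<in>B. sign T a * signed_sum w T Bs (insert a e0))"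
  proof -
    have "(\<Sum>e | e \<subseteq> ?Y \<and> card e = ?k. w (e \<union> insert a e0) * (\<Prod>B\<leftarrow>Bs. side T B e))
      = signed_sum w T Bs (insert a e0)" for a
      using Cons.prems by (intro Cons.IH) auto
    then show ?thesis by (simp only:)
  qed
  finally show ?case by simp
qed

lemma signed_sum_le_discrepancy:
  assumes "\<forall>B\<in>set Bs. finite B" "disjoint_list Bs"
    "\<And>S. S \<subseteq> \<Union>(set Bs) \<Longrightarrow> \<bar>\<Sum>e | e \<subseteq> S \<and> card e = length Bs. w e\<bar> \<le> M"
  shows "\<bar>signed_sum w T Bs {}\<bar> \<le> 2 ^ length Bs * M"
proof -
  have "signed_sum w T Bs {} = alternating (\<lambda>S. \<Sum>e | e \<subseteq> S \<and> card e = length Bs. w e) T Bs {}"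
    using alternating_subset_sum[where S = "{}" and Bs = Bs and m = "length Bs" and w = w and T = T]
      sum_sides_eq_signed_sum[where Bs = Bs and w = w and T = T and ?e0.0 = "{}"] assms(1,2)
    by simp
  then show ?thesis
    using alternating_le[of "\<Union>(set Bs)" _ M "{}" Bs T] assms(3) by simp
qed

section \<open>Large weighted discrepancy\<close>

lemma exists_disjoint_list:
  assumes "finite V" "k * s \<le> card V"
  shows "\<exists>Bs. length Bs = k \<and> disjoint_list Bs \<and> (\<forall>B\<in>set Bs. B \<subseteq> V \<and> card B = s)"
  using assms
proof (induction k arbitrary: V)
  case (Suc k)
  then have "s \<le> card V" by simp
  then obtain B where B: "B \<subseteq> V" "card B = s" "finite B"
    by (rule obtain_subset_with_card_n)
  have "k * s \<le> card (V - B)" using Suc.prems B by (simp add: card_Diff_subset)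
  then obtain Bs where "length Bs = k" "disjoint_list Bs" "\<forall>A\<in>set Bs. A \<subseteq> V - B \<and> card A = s"
    using Suc.IH[of "V - B"] Suc.prems by auto
  then show ?case using B by (intro exI[of _ "B # Bs"]) auto
qed simp

lemma card_Union_disjoint_list:
  assumes "disjoint_list Bs" "\<forall>B\<in>set Bs. finite B \<and> card B = s"
  shows "card (\<Union>(set Bs)) = length Bs * s"
  using assms
proof (induction Bs)
  case (Cons B Bs)
  have "card (B \<union> \<Union>(set Bs)) = card B + card (\<Union>(set Bs))"
    using Cons.prems by (intro card_Un_disjoint) auto
  then show ?case using Cons by simp
qed simp

text \<open>The averaging over \<open>v\<close>. The hypothesis \<open>big\<close> says that, in a random colouring, the expected number of
vertices \<open>v\<close> with a large signed sum is at least \<open>s\<close>.\<close>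

lemma weighted_discrepancy:
  fixes w :: "'a set \<Rightarrow> real" and r :: nat
  defines "\<beta> \<equiv> tail_prob (r - 2)"
  assumes r: "r \<ge> 2" and V: "finite V"
    and q: "q > 0" "\<And>f. finite f \<Longrightarrow> card f = r \<Longrightarrow> q \<le> \<bar>w f\<bar>"
    and s: "s > 0" and j: "j \<ge> 1" "j = 1 \<or> real j \<le> \<beta> / 2 * real s" and rs: "(r - 1) * s \<le> card V"
    and big: "real s \<le> \<beta> / 2 * (1/10) ^ j * real (card V - (r - 1) * s)"
  obtains S where "S \<subseteq> V" "card S \<le> r * s"
    "q * (tail_scale (r - 2) * sqrt (\<beta> / 2) / (8 * 2 ^ r)) * sqrt (real s) ^ (r + 1) * sqrt (real j)
      \<le> \<bar>\<Sum>e | e \<subseteq> S \<and> card e = r. w e\<bar>"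
proof -
  define \<alpha> where "\<alpha> = tail_scale (r - 2)"
  have ab: "0 < \<alpha>" "0 < \<beta>" by (auto simp: \<alpha>_def \<beta>_def tail_scale_pos tail_prob_bounds)
  obtain Cs where Cs: "length Cs = r - 1" "disjoint_list Cs" "\<forall>B\<in>set Cs. B \<subseteq> V \<and> card B = s"
    using exists_disjoint_list[OF V rs] by auto
  then obtain B Bs where CB: "Cs = B # Bs" using r by (cases Cs) auto
  have len: "length Bs = r - 2" using Cs CB by simp
  define Y where "Y = \<Union>(set Cs)"
  define U where "U = V - Y"
  have finC: "\<forall>B\<in>set Cs. finite B" using Cs V finite_subset by blast
  have Y: "finite Y" "Y \<subseteq> V" "card Y = (r - 1) * s"
    using Cs finC card_Union_disjoint_list[of Cs s] by (auto simp: Y_def)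
  have U: "finite U" "card U = card V - (r - 1) * s" using V Y by (auto simp: U_def card_Diff_subset)
  define c where "c = q * \<alpha> * sqrt (real s) ^ (r - 2) * sqrt (\<beta> / 2 * real s * real j) / 4"
  have c: "c > 0" using q ab s j by (simp add: c_def)
  have B: "finite B" "card B = s" "B \<noteq> {}" "B \<inter> \<Union>(set Bs) = {}" "finite (\<Union>(set Bs))"
    using Cs CB finC s by auto
  have tail: "\<beta> / 2 * (1/10) ^ j * real (card (Pow Y))
     \<le> real (card {T\<in>Pow Y. c \<le> \<bar>signed_sum w T Cs {v}\<bar>})" if v: "v \<in> U" for v
  proof -
    have "\<beta> / 2 * (1/10) ^ j * 2 ^ card (\<Union>(set (B # Bs)))
      \<le> real (card {T\<in>Pow (\<Union>(set (B # Bs))).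
          q * \<alpha> * sqrt (real s) ^ (r - 2) * sqrt (\<beta> / 2 * real (card B) * real j) / 4
            \<le> \<bar>signed_sum w T (B # Bs) {v}\<bar>})"
    proof (rule signed_sum_Cons_anticoncentration)
      fix a assume a: "a \<in> B"
      have av: "a \<noteq> v" "{a, v} \<inter> \<Union>(set Bs) = {}" using a v B CB by (auto simp: U_def Y_def)
      show "\<beta> * 2 ^ card (\<Union>(set Bs)) \<le> real (card {T\<in>Pow (\<Union>(set Bs)).
          q * \<alpha> * sqrt (real s) ^ (r - 2) \<le> \<bar>signed_sum w T Bs {a, v}\<bar>})"
        unfolding \<alpha>_def \<beta>_def len[symmetric]
        by (rule signed_sum_anticoncentration) (use Cs CB finC s q r av len in auto)
    qed (use B q ab s j in auto)
    then show ?thesis using B Y(1) by (simp add: c_def Y_def CB card_Pow del: signed_sum.simps)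
  qed
  have "\<exists>T\<in>Pow Y. \<beta> / 2 * (1/10) ^ j * real (card U) \<le> real (card {v\<in>U. c \<le> \<bar>signed_sum w T Cs {v}\<bar>})"
    by (rule exists_typical_point[OF U(1) _ _ tail]) (use Y in auto)
  then obtain T where T: "T \<subseteq> Y"
    "\<beta> / 2 * (1/10) ^ j * real (card U) \<le> real (card {v\<in>U. c \<le> \<bar>signed_sum w T Cs {v}\<bar>})"
    by auto
  then have "s \<le> card {v\<in>U. c \<le> \<bar>signed_sum w T Cs {v}\<bar>}"
    using big U by simp
  then obtain A where A: "A \<subseteq> {v\<in>U. c \<le> \<bar>signed_sum w T Cs {v}\<bar>}" "card A = s" "finite A"
    by (rule obtain_subset_with_card_n)
  have AY: "A \<inter> Y = {}" "A \<subseteq> V" using A by (auto simp: U_def)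
  \<comment> \<open>Colouring each \<open>v\<close> by the sign of its sum makes all contributions nonnegative.\<close>
  define T' where "T' = T \<union> {v\<in>A. signed_sum w T Cs {v} \<ge> 0}"
  have "signed_sum w T' Cs e = signed_sum w T Cs e" for e
    using AY by (intro signed_sum_cong) (auto simp: T'_def Y_def)
  then have "signed_sum w T' (A # Cs) {} = (\<Sum>v\<in>A. sign T' v * signed_sum w T Cs {v})" by simp
  also have "\<dots> = (\<Sum>v\<in>A. \<bar>signed_sum w T Cs {v}\<bar>)"
    using T AY by (intro sum.cong) (auto simp: T'_def sign_def)
  also have "\<dots> \<ge> (\<Sum>v\<in>A. c)" using A by (intro sum_mono) auto
  finally have lower: "real s * c \<le> signed_sum w T' (A # Cs) {}" using A by simp
  \<comment> \<open>Half of what polarization yields; the slack turns its weak inequality into a contradiction.\<close>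
  define M where "M = real s * c / (2 * 2 ^ r)"
  have "\<exists>S\<subseteq>\<Union>(set (A # Cs)). M \<le> \<bar>\<Sum>e | e \<subseteq> S \<and> card e = r. w e\<bar>"
  proof (rule ccontr)
    assume none: "\<not> ?thesis"
    have *: "\<bar>\<Sum>e | e \<subseteq> S \<and> card e = length (A # Cs). w e\<bar> \<le> M"
      if "S \<subseteq> \<Union>(set (A # Cs))" for S
    proof -
      have "\<not> M \<le> \<bar>\<Sum>e | e \<subseteq> S \<and> card e = r. w e\<bar>" using none that by blast
      moreover have "length (A # Cs) = r" using Cs r by simp
      ultimately show ?thesis by simp
    qed
    have "\<bar>signed_sum w T' (A # Cs) {}\<bar> \<le> 2 ^ length (A # Cs) * M"
      by (rule signed_sum_le_discrepancy) (use * finC A Cs AY in \<open>auto simp: Y_def\<close>)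
    also have "\<dots> = real s * c / 2" using Cs r by (simp add: M_def)
    also have "\<dots> < real s * c" using s c by simp
    finally show False using lower by linarith
  qed
  then obtain S where S: "S \<subseteq> A \<union> Y" "M \<le> \<bar>\<Sum>e | e \<subseteq> S \<and> card e = r. w e\<bar>"
    by (auto simp: Y_def)
  have "card S \<le> card (A \<union> Y)" using S A Y by (intro card_mono) auto
  also have "\<dots> \<le> s + (r - 1) * s" using card_Un_le[of A Y] A Y by simp
  also have "\<dots> = r * s" using r by (cases r) auto
  finally have "card S \<le> r * s" .
  moreover have "S \<subseteq> V" using S AY Y by auto
  moreover have "M = q * (\<alpha> * sqrt (\<beta> / 2) / (8 * 2 ^ r)) * sqrt (real s) ^ (r + 1) * sqrt (real j)"
  proof -
    have "r + 1 = (r - 2) + 3" using r by simp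
    then have "sqrt (real s) ^ (r + 1) = sqrt (real s) ^ (r - 2) * sqrt (real s) * real s"
      by (simp only: power_add) (simp add: power3_eq_cube)
    moreover have "sqrt (\<beta> / 2 * real s * real j) = sqrt (\<beta> / 2) * sqrt (real s) * sqrt (real j)"
      by (simp only: real_sqrt_mult)
    ultimately show ?thesis by (simp only: M_def c_def) simp
  qed
  ultimately show ?thesis using S(2) by (intro that[of S]) (auto simp: \<alpha>_def)
qed

section \<open>The bound for hypergraphs\<close>

lemma p_discrepancy_eq_sum:
  assumes "uniform_hypergraph r V E" "S \<subseteq> V"
  shows "p_discrepancy r E p S = (\<Sum>e | e \<subseteq> S \<and> card e = r. of_bool (e \<in> E) - p)"
proof -
  have fin: "finite S" using assms finite_subset by (auto simp: uniform_hypergraph_def)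
  have "{e \<in> E. e \<subseteq> S} = {e. e \<subseteq> S \<and> card e = r} \<inter> E"
    using assms by (auto simp: uniform_hypergraph_def)
  then show ?thesis
    using fin n_subsets[OF fin, of r]
    by (simp add: p_discrepancy_def edges_inside_def sum_subtractf of_bool_def sum.If_cases Int_def)
qed

text \<open>The choice of parameters. With \<open>L = ln (n / t)\<close> and \<open>j = \<lceil>L / 8\<rceil>\<close>, the estimate \<open>10 \<le> exp 4\<close> gives
\<open>10\<^sup>-\<^sup>j \<ge> exp (- L / 2) / 10 = sqrt (t / n) / 10\<close>. At least \<open>n / 2\<close> vertices are outside the first
\<open>r - 1\<close> sets, so the expected number of good vertices is at least \<open>\<beta> / 40 * sqrt (t * n)\<close>,
and \<open>K = (40 / \<beta>)\<^sup>2\<close> makes this at least \<open>t \<ge> s\<close>. The value of \<open>D\<close> gives \<open>\<beta> / 2 * s \<ge> ln n\<close>, more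
than \<open>j \<le> ln n / 8 + 1\<close> blocks need. Both constants depend on \<open>r\<close> only, not on \<open>p\<close>.\<close>

lemma discrepancy_for_small_t:
  assumes r: "r \<ge> 2"
  obtains C D K :: real where "0 < C" "0 < D" "1 < K"
    "\<And>(p :: real) (t :: real) (V :: 'a set) E. \<lbrakk>0 < p; p < 1; ln (card V) \<ge> 2; ln (card V) / D \<le> t; t \<le> card V / K;
      uniform_hypergraph r V E\<rbrakk> \<Longrightarrow>
      \<exists>S\<subseteq>V. card S \<le> t \<and>
        C * min p (1 - p) * t powr ((real r + 1) / 2) * sqrt (ln (card V / t)) \<le> \<bar>p_discrepancy r E p S\<bar>"
proof -
  define \<beta> where "\<beta> = tail_prob (r - 2)"
  define \<alpha> where "\<alpha> = tail_scale (r - 2) * sqrt (\<beta> / 2) / (8 * 2 ^ r)"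
  have ab: "0 < \<alpha>" "0 < \<beta>" "\<beta> \<le> 1" by (auto simp: \<alpha>_def \<beta>_def tail_scale_pos tail_prob_bounds)
  define D where "D = \<beta> / (4 * real r)"
  define K where "K = (40 / \<beta>)^2"
  define C where "C = \<alpha> * (1 / (2 * real r)) powr ((real r + 1) / 2) * sqrt (1/8)"
  have K: "K \<ge> 2"
  proof -
    have "40 \<le> 40 / \<beta>" using ab by (simp add: field_simps)
    then have "40^2 \<le> K" unfolding K_def by (intro power_mono) auto
    then show ?thesis by simp
  qed
  have "\<exists>S\<subseteq>V. card S \<le> t \<and>
        C * min p (1 - p) * t powr ((real r + 1) / 2) * sqrt (ln (card V / t)) \<le> \<bar>p_discrepancy r E p S\<bar>"
    if p: "0 < p" "p < 1" and n: "ln (card V) \<ge> 2" and t: "ln (card V) / D \<le> t" "t \<le> card V / K"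
      and H: "uniform_hypergraph r V E" for p t :: real and V :: "'a set" and E
  proof -
    define n where "n = real (card V)"
    define L where "L = ln (n / t)"
    define s where "s = nat \<lfloor>t / real r\<rfloor>"
    define j where "j = nat \<lceil>L / 8\<rceil>"
    have n: "ln n \<ge> 2" "n > 0" using n by (auto simp: n_def intro!: Nat.gr0I)
    have t0: "4 * real r * ln n \<le> \<beta> * t"
      using t(1) ab r by (simp add: n_def D_def field_simps)
    also have "\<dots> \<le> t"
    proof -
      have "0 < ln n" using n by linarith
      then have "0 < 4 * real r * ln n" using r by (intro mult_pos_pos) auto
      then have "0 < \<beta> * t" using t0 by linarith
      then have "0 < t" using ab by (simp add: zero_less_mult_iff)
      then show ?thesis using ab by simp
    qed
    finally have t1: "4 * real r * ln n \<le> t" .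
    have "4 * real r * 2 \<le> 4 * real r * ln n" using n by (intro mult_left_mono) auto
    then have tr: "8 * real r \<le> t" using t1 by linarith
    then have tpos: "t \<ge> 1" "t > 0" using r by linarith+
    have tn: "t \<le> n / K" using t by (simp add: n_def)
    have nt: "n / t \<ge> K" using tn tpos K by (simp add: field_simps)
    have L: "L > 0" "L \<le> ln n"
    proof -
      show "L > 0" unfolding L_def using nt K by (intro ln_gt_zero) linarith
      have "n / t \<le> n" using tpos n by (simp add: field_simps)
      then show "L \<le> ln n" unfolding L_def using nt K n by (intro ln_mono) auto
    qed
    have tr8: "t / real r \<ge> 8" using tr r by (simp add: field_simps)
    have s: "real s \<le> t / real r" "real s > t / real r - 1" unfolding s_def using tr8 by linarith+
    have s2: "real s \<ge> t / (2 * real r)" using s(2) tr8 by (simp add: field_simps)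
    have s0: "s > 0" using s tr8 by (intro Nat.gr0I) auto
    have rs: "real r * real s \<le> t" using s r by (simp add: field_simps)
    have j: "real j \<ge> L / 8" "real j < L / 8 + 1" "j \<ge> 1" unfolding j_def using L by linarith+
    have jb: "real j \<le> \<beta> / 2 * real s"
    proof -
      have "\<beta> / 2 * (t / (2 * real r)) \<le> \<beta> / 2 * real s" using s2 ab by (intro mult_left_mono) auto
      moreover have "\<beta> / 2 * (t / (2 * real r)) \<ge> ln n" using t0 r by (simp add: field_simps)
      ultimately show ?thesis using j L n by linarith
    qed
    have rs1: "real ((r - 1) * s) \<le> t"
    proof -
      have "real ((r - 1) * s) \<le> real (r * s)" by (intro of_nat_mono mult_right_mono) auto
      then show ?thesis using rs by simp
    qed
    have tn2: "t \<le> n / 2"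
      using tn K n by (smt (verit, best) frac_le)
    have rsn: "(r - 1) * s \<le> card V"
      using rs1 tn2 n unfolding n_def by linarith
    have half: "n / 2 \<le> real (card V - (r - 1) * s)"
      using rs1 tn2 rsn of_nat_diff[OF rsn, where 'a = real] unfolding n_def by linarith
    have ten: "(10::real) \<le> exp 4"
    proof -
      have "(2::real)^4 \<le> exp 1 ^ 4" using exp_ge_add_one_self[of 1] by (intro power_mono) auto
      also have "\<dots> = exp 4" by (simp flip: exp_of_nat_mult)
      finally show ?thesis by simp
    qed
    have pow: "(1/10) ^ j \<ge> 1/10 * exp (- L / 2)"
    proof -
      have "exp (- L / 2) \<le> exp (- 4 * real (j - 1))" using j by (simp add: of_nat_diff)
      also have "\<dots> = exp (- 4) ^ (j - 1)" by (simp add: mult.commute flip: exp_of_nat_mult)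
      also have "\<dots> \<le> (1/10) ^ (j - 1)" using ten by (intro power_mono) (auto simp: exp_minus field_simps)
      finally have "1/10 * exp (- L / 2) \<le> 1/10 * (1/10) ^ (j - 1)" by simp
      also have "\<dots> = (1/10) ^ j" using j(3) by (cases j) auto
      finally show ?thesis .
    qed
    have expL: "exp (- L / 2) = sqrt (t / n)"
    proof -
      have "exp (- L / 2) ^ 2 = exp (- L)" by (simp flip: exp_of_nat_mult)
      also have "\<dots> = t / n" unfolding L_def using tpos n by (simp add: exp_minus)
      finally show ?thesis by (metis exp_ge_zero real_sqrt_unique)
    qed
    have "t / real r \<le> t" using r tpos by (simp add: field_simps)
    then have "real s \<le> t" using s by linarith
    have big: "real s \<le> \<beta> / 2 * (1/10) ^ j * real (card V - (r - 1) * s)"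
    proof -
      have "sqrt (t / n) \<le> sqrt ((\<beta> / 40)^2)"
        using tn n ab unfolding K_def by (intro real_sqrt_le_mono) (simp add: field_simps)
      then have "sqrt (t / n) \<le> \<beta> / 40" using ab by simp
      then have "sqrt (t / n) * sqrt (t / n) \<le> \<beta> / 40 * sqrt (t / n)"
        using tpos n by (intro mult_right_mono) auto
      then have "t / n \<le> \<beta> / 40 * sqrt (t / n)" using tpos n by simp
      then have "t \<le> \<beta> / 40 * sqrt (t / n) * n" using n by (simp add: field_simps)
      also have "\<dots> = \<beta> / 2 * (1/10 * exp (- L / 2)) * (n / 2)" unfolding expL by simp
      also have "\<dots> \<le> \<beta> / 2 * (1/10) ^ j * real (card V - (r - 1) * s)"
        using ab n by (intro mult_mono[OF mult_left_mono[OF pow] half]) auto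
      finally show ?thesis using \<open>real s \<le> t\<close> by linarith
    qed
    define q where "q = min p (1 - p)"
    define w where "w = (\<lambda>e. of_bool (e \<in> E) - p)"
    have q: "q > 0" "q \<le> \<bar>w e\<bar>" for e using p by (auto simp: q_def w_def)
    have finV: "finite V" using H by (simp add: uniform_hypergraph_def)
    obtain S where S: "S \<subseteq> V" "card S \<le> r * s"
      "q * \<alpha> * sqrt (real s) ^ (r + 1) * sqrt (real j) \<le> \<bar>\<Sum>e | e \<subseteq> S \<and> card e = r. w e\<bar>"
      unfolding \<alpha>_def \<beta>_def
      by (rule weighted_discrepancy[OF r finV q(1) q(2) s0 j(3) _ rsn])
        (use jb big in \<open>auto simp: \<beta>_def\<close>)
    have "real (card S) \<le> real (r * s)" using S(2) by (rule of_nat_mono)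
    then have cS: "real (card S) \<le> t" using rs by simp
    have "(1 / (2 * real r)) powr ((real r + 1) / 2) * t powr ((real r + 1) / 2)
       = (t / (2 * real r)) powr ((real r + 1) / 2)"
      using tpos by (simp add: powr_mult[symmetric])
    also have "\<dots> \<le> real s powr ((real r + 1) / 2)"
      using s2 tpos by (intro powr_mono2) auto
    also have "\<dots> = sqrt (real s) ^ (r + 1)"
      using s0 by (simp add: powr_half_sqrt[symmetric] powr_powr powr_realpow[symmetric] add.commute del: power_Suc)
    finally have 1: "(1 / (2 * real r)) powr ((real r + 1) / 2) * t powr ((real r + 1) / 2) \<le> sqrt (real s) ^ (r + 1)" .
    have 2: "sqrt (1/8) * sqrt L \<le> sqrt (real j)"
      using j(1) by (simp add: real_sqrt_mult[symmetric])
    have "C * q * t powr ((real r + 1) / 2) * sqrt L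
      = q * \<alpha> * (((1 / (2 * real r)) powr ((real r + 1) / 2) * t powr ((real r + 1) / 2)) * (sqrt (1/8) * sqrt L))"
      by (simp only: C_def mult_ac)
    also have "\<dots> \<le> q * \<alpha> * (sqrt (real s) ^ (r + 1) * sqrt (real j))"
      using 1 2 q(1) ab L by (intro mult_left_mono mult_mono) auto
    also have "\<dots> \<le> \<bar>p_discrepancy r E p S\<bar>"
      using S(3) p_discrepancy_eq_sum[OF H S(1), of p] by (simp add: w_def mult.assoc)
    finally show ?thesis using S(1) cS unfolding L_def n_def q_def by blast
  qed
  moreover have "0 < C" "0 < D" using ab r by (auto simp: C_def D_def)
  moreover have "1 < K" using K by simp
  ultimately show ?thesis by (intro that[of C D K])
qed

theorem theorem4:
  fixes r :: nat
  assumes "r \<ge> 2"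
  shows "\<exists>C D :: real. C > 0 \<and> D > 0 \<and>
    (\<forall>p :: real. 0 < p \<and> p < 1 \<longrightarrow>
      (\<exists>N :: nat. \<forall>n \<ge> N. \<forall>t :: real. ln (real n) / D \<le> t \<and> t \<le> real n \<longrightarrow>
        (\<forall>(V :: 'a set) E. uniform_hypergraph r V E \<and> card V = n \<longrightarrow>
          Max ((\<lambda>S. \<bar>p_discrepancy r E p S\<bar>) ` {S. S \<subseteq> V \<and> real (card S) \<le> t})
            \<ge> C * min p (1 - p) * t powr ((real r + 1) / 2) * sqrt (ln (real n / t)))))"
proof (rule discrepancy_for_small_t[OF assms, where 'a = 'a])
  fix C D K :: real
  assume CDK: "0 < C" "0 < D" "1 < K" and
    sparse: "\<And>(p :: real) (t :: real) (V :: 'a set) E. \<lbrakk>0 < p; p < 1; ln (card V) \<ge> 2; ln (card V) / D \<le> t; t \<le> card V / K;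
      uniform_hypergraph r V E\<rbrakk> \<Longrightarrow>
      \<exists>S\<subseteq>V. card S \<le> t \<and>
        C * min p (1 - p) * t powr ((real r + 1) / 2) * sqrt (ln (card V / t)) \<le> \<bar>p_discrepancy r E p S\<bar>"
  define \<gamma> where "\<gamma> = (real r + 1) / 2"
  define C' where "C' = C * (1 / K) powr \<gamma>"
  define N where "N = nat \<lceil>max (exp 2) ((2 * K / D)^2)\<rceil>"
  have large: "C' * min p (1 - p) * t powr \<gamma> * sqrt (ln (real n / t))
      \<le> Max ((\<lambda>S. \<bar>p_discrepancy r E p S\<bar>) ` {S. S \<subseteq> V \<and> real (card S) \<le> t})"
    if p: "0 < p" "p < 1" and nN: "n \<ge> N" and t: "ln (real n) / D \<le> t" "t \<le> real n"
      and H: "uniform_hypergraph r V E" "card V = n" for p t :: real and n and V :: "'a set" and E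
  proof -
    have n: "real n \<ge> exp 2" "real n \<ge> (2 * K / D)^2" using nN unfolding N_def by linarith+
    have npos: "real n > 0" using n(1) exp_gt_zero[of "2::real"] by linarith
    have ln2: "ln (real n) \<ge> 2" using n npos by (simp add: ln_ge_iff)
    have tpos: "t > 0" using t(1) ln2 CDK by (smt (verit) divide_pos_pos)
    \<comment> \<open>Passing from \<open>t\<close> to \<open>u \<ge> t / K\<close> loses only a constant factor, and \<open>ln (n / u) \<ge> ln (n / t)\<close>.\<close>
    define u where "u = min t (real n / K)"
    have upos: "u > 0" using tpos npos CDK by (simp add: u_def)
    have ut: "u \<le> t" "u \<le> real n / K" "t / K \<le> u"
      using tpos CDK t by (auto simp: u_def min_def field_simps)
    \<comment> \<open>Here \<open>ln n = 2 ln (sqrt n) \<le> 2 sqrt n \<le> D n / K\<close>.\<close>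
    have "ln (real n) / D \<le> real n / K"
    proof -
      have "2 * K / D \<le> sqrt (real n)" using n(2) CDK by (intro real_le_rsqrt) auto
      then have "2 * K / D * sqrt (real n) \<le> sqrt (real n) * sqrt (real n)" by (intro mult_right_mono) auto
      then have 1: "2 * sqrt (real n) / D \<le> real n / K" using CDK by (simp add: field_simps)
      have "ln (real n) = 2 * ln (sqrt (real n))" using npos by (simp add: ln_sqrt)
      also have "\<dots> \<le> 2 * sqrt (real n)" using npos ln_bound[of "sqrt (real n)"] by simp
      finally have "ln (real n) / D \<le> 2 * sqrt (real n) / D" using CDK by (intro divide_right_mono) auto
      then show ?thesis using 1 by linarith
    qed
    then have lnu: "ln (real n) / D \<le> u" using t by (simp add: u_def)
    obtain S where S: "S \<subseteq> V" "real (card S) \<le> u"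
      "C * min p (1 - p) * u powr \<gamma> * sqrt (ln (real n / u)) \<le> \<bar>p_discrepancy r E p S\<bar>"
      using sparse[of p V u E] p ln2 lnu ut H unfolding \<gamma>_def by auto
    have "C' * min p (1 - p) * t powr \<gamma> * sqrt (ln (real n / t))
      = C * min p (1 - p) * (t / K) powr \<gamma> * sqrt (ln (real n / t))"
      using tpos CDK by (simp add: C'_def powr_divide)
    also have "\<dots> \<le> C * min p (1 - p) * u powr \<gamma> * sqrt (ln (real n / u))"
    proof (intro mult_mono mult_left_mono real_sqrt_le_mono)
      show "(t / K) powr \<gamma> \<le> u powr \<gamma>" using ut tpos CDK by (intro powr_mono2) (auto simp: \<gamma>_def)
      show "ln (real n / t) \<le> ln (real n / u)"
        using ut upos tpos npos by (intro ln_mono divide_left_mono) auto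
    qed (use CDK p t tpos in auto)
    also have "\<dots> \<le> \<bar>p_discrepancy r E p S\<bar>" by (rule S)
    also have "\<dots> \<le> Max ((\<lambda>S. \<bar>p_discrepancy r E p S\<bar>) ` {S. S \<subseteq> V \<and> real (card S) \<le> t})"
    proof (rule Max_ge)
      have "finite V" using H by (simp add: uniform_hypergraph_def)
      then show "finite ((\<lambda>S. \<bar>p_discrepancy r E p S\<bar>) ` {S. S \<subseteq> V \<and> real (card S) \<le> t})" by simp
    qed (use S ut in auto)
    finally show ?thesis .
  qed
  have "0 < C'" using CDK by (simp add: C'_def)
  then show ?thesis using CDK(2) large unfolding \<gamma>_def by blast
qed

end
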